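(* Let $\widehat{X}=A+\epsilon_1 A_0$ and $\widehat{Y}=C+\epsilon_1 C_0$ be $n\times n$ dual matrices such that $Ind(A)=Ind(C)=1$. Suppose that the DGGI of each of $\widehat{X}$, $\widehat{Y}$ and $\widehat{X}\widehat{Y}$ exists, that $AA^{\#}A_0=A_0AA^{\#}=A_0$, and that $CC^{\#}C_0=C_0CC^{\#}=C_0$. If $AC=CA$, $C^{\#}A_0=A_0C^{\#}$ and $A^{\#}C_0=C_0A^{\#}$, then $$(\widehat{X}\widehat{Y})^{\#}=\widehat{X}^{\#}\widehat{Y}^{\#}=\widehat{Y}^{\#}\widehat{X}^{\#}.$$
   Context: Dual numbers are elements $a+\epsilon_1 a_0$ with $a,a_0\in\mathbb{R}$, $\epsilon_1\ne0$, $\epsilon_1^2=0$ (the ring $\mathbb{R}[\epsilon_1]/(\epsilon_1^2)$). A dual matrix is $A+\epsilon_1A_0$ with $A,A_0\in\mathbb{R}^{n\times n}$. The group inverse of a square matrix $M$ (real or dual) is the (unique, if it exists) matrix $G=M^{\#}$ of the same type with $MGM=M$, $GMG=G$, $MG=GM$. For dual matrices it is called the dual group generalized inverse (DGGI). $Ind(A)$ is the index of the real matrix $A$; $Ind(A)=1$ is understood here as the ranges of $A^2$ and $A$ coinciding, equivalently as $A^{\#}$ existing. *)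

theory Defs
  imports "HOL-Analysis.Analysis"
begin

section \<open>The ring of dual numbers\<close>

datatype dual = Dual (dual_std: real) (dual_inf: real)

instantiation dual :: comm_ring_1
begin

definition zero_dual :: dual where
  "0 = Dual 0 0"

definition one_dual :: dual where
  "1 = Dual 1 0"

definition plus_dual :: "dual \<Rightarrow> dual \<Rightarrow> dual" where
  "x + y = Dual (dual_std x + dual_std y) (dual_inf x + dual_inf y)"

definition minus_dual :: "dual \<Rightarrow> dual \<Rightarrow> dual" where
  "x - y = Dual (dual_std x - dual_std y) (dual_inf x - dual_inf y)"

definition uminus_dual :: "dual \<Rightarrow> dual" where
  "- x = Dual (- dual_std x) (- dual_inf x)"

definition times_dual :: "dual \<Rightarrow> dual \<Rightarrow> dual" where
  "x * y = Dual (dual_std x * dual_std y) (dual_std x * dual_inf y + dual_inf x * dual_std y)"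

instance
  by standard
    (simp_all add: zero_dual_def one_dual_def plus_dual_def minus_dual_def
      uminus_dual_def times_dual_def dual.expand algebra_simps)

end

definition dual_eps :: dual where
  "dual_eps = Dual 0 1"

lemma dual_eps_nonzero: "dual_eps \<noteq> 0"
  by (simp add: dual_eps_def zero_dual_def)

lemma dual_eps_square: "dual_eps * dual_eps = 0"
  by (simp add: dual_eps_def times_dual_def zero_dual_def)

lemma Dual_eq: "Dual a b = Dual a 0 + dual_eps * Dual b 0"
  by (simp add: dual_eps_def times_dual_def plus_dual_def)


section \<open>Dual matrices\<close>

text \<open>The dual matrix \<open>A + \<epsilon> A0\<close>.\<close>

definition dual_matrix :: "real^'n^'m \<Rightarrow> real^'n^'m \<Rightarrow> dual^'n^'m" where
  "dual_matrix A A0 = (\<chi> i j. Dual (A $ i $ j) 0 + dual_eps * Dual (A0 $ i $ j) 0)"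


section \<open>Group inverse and index\<close>

definition is_group_inverse :: "'a::semiring_1^'n^'n \<Rightarrow> 'a^'n^'n \<Rightarrow> bool" where
  "is_group_inverse M G \<longleftrightarrow> M ** G ** M = M \<and> G ** M ** G = G \<and> M ** G = G ** M"

lemma is_group_inverse_unique:
  assumes "is_group_inverse M G" and "is_group_inverse M H"
  shows "G = H"
proof -
  from assms have G: "M ** G ** M = M" "G ** M ** G = G" "M ** G = G ** M"
    and H: "M ** H ** M = M" "H ** M ** H = H" "M ** H = H ** M"
    unfolding is_group_inverse_def by blast+
  have "G ** M = H ** M ** (G ** M)"
    by (metis G(3) H(1,3) matrix_mul_assoc)
  also have "\<dots> = H ** M"
    by (metis G(1) matrix_mul_assoc)
  finally have E: "G ** M = H ** M" .
  show ?thesis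
    by (metis E G(2,3) H(2,3) matrix_mul_assoc)
qed

definition has_group_inverse :: "'a::semiring_1^'n^'n \<Rightarrow> bool" where
  "has_group_inverse M \<longleftrightarrow> (\<exists>G. is_group_inverse M G)"

text \<open>Unspecified when \<open>M\<close> has no group inverse.\<close>

definition group_inverse :: "'a::semiring_1^'n^'n \<Rightarrow> 'a^'n^'n" where
  "group_inverse M = (THE G. is_group_inverse M G)"

lemma is_group_inverse_group_inverse:
  "has_group_inverse M \<Longrightarrow> is_group_inverse M (group_inverse M)"
  unfolding has_group_inverse_def group_inverse_def
  by (metis is_group_inverse_unique theI)

text \<open>The convention for ``index one'' is that the ranges of \<open>A\<^sup>2\<close> and \<open>A\<close> coincide;
  in particular it includes the invertible matrices.\<close>

definition index_one :: "real^'n^'n \<Rightarrow> bool" where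
  "index_one A \<longleftrightarrow> range ((*v) (A ** A)) = range ((*v) A)"

end

theory Submission
  imports Defs
begin

text \<open>Taking group inverses preserves commutation, in both directions because \<open>A\<close> is the group
  inverse of \<open>A\<^sup>#\<close>. Hence the hypotheses make \<open>A\<close> commute with \<open>C\<^sub>0\<close> and \<open>C\<close> with \<open>A\<^sub>0\<close>, so that
  \<open>X\<close> and \<open>Y\<close> commute, and for commuting matrices the product of the group inverses
  is the group inverse of the product.\<close>

lemma is_group_inverse_sym: "is_group_inverse M G \<Longrightarrow> is_group_inverse G M"
  unfolding is_group_inverse_def by auto

lemma group_inverse_eqI: "is_group_inverse M G \<Longrightarrow> group_inverse M = G"
  unfolding group_inverse_def by (blast intro: is_group_inverse_unique)

text \<open>The idempotent \<open>E = G ** M\<close> is a two-sided identity for both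
  \<open>M\<close> and \<open>G\<close>. Commutation of \<open>B\<close> with \<open>M\<close> makes
  \<open>E ** B\<close> and \<open>B ** E\<close> both equal to \<open>E ** B ** E\<close>, and
  commutation with \<open>E\<close> then carries over to \<open>G\<close>.\<close>

lemma is_group_inverse_commute:
  assumes "is_group_inverse M G" and BM: "B ** M = M ** B"
  shows "B ** G = G ** B"
proof -
  have MGM: "M ** G ** M = M" and GMG: "G ** M ** G = G" and MG: "M ** G = G ** M"
    using assms(1) unfolding is_group_inverse_def by blast+
  define E where "E = G ** M"
  have EM: "E ** M = M" and ME: "M ** E = M" and EG: "E ** G = G" and GE: "G ** E = G"
    and ME': "M ** G = E"
    unfolding E_def using MGM GMG MG by (metis matrix_mul_assoc)+
  \<comment> \<open>Over a ring, this chain says that \<open>B\<close> preserves the kernel of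
    \<open>E\<close>, and the next one that \<open>B\<close> preserves its range.\<close>
  have "E ** B = G ** B ** M"
    by (simp add: E_def BM flip: matrix_mul_assoc)
  also have "\<dots> = G ** B ** M ** E"
    by (simp add: ME flip: matrix_mul_assoc)
  also have "\<dots> = E ** B ** E"
    by (metis E_def BM matrix_mul_assoc)
  finally have l: "E ** B = E ** B ** E" .
  have "B ** E = M ** B ** G"
    by (simp add: matrix_mul_assoc BM flip: ME')
  also have "\<dots> = E ** M ** B ** G"
    by (simp add: EM)
  also have "\<dots> = E ** B ** E"
    by (metis ME' BM matrix_mul_assoc)
  finally have EB: "E ** B = B ** E"
    using l by simp
  \<comment> \<open>Inserting \<open>E\<close> beside \<open>G\<close> and moving it left past
    \<open>B\<close> supplies a factor \<open>M\<close>; moved back to the right, it turns the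
    second \<open>G\<close> into \<open>E\<close>, which the first \<open>G\<close> absorbs.\<close>
  have "B ** G = B ** E ** G"
    by (simp add: EG flip: matrix_mul_assoc)
  also have "\<dots> = G ** M ** B ** G"
    by (metis EB E_def)
  also have "\<dots> = G ** B ** E"
    by (metis BM ME' matrix_mul_assoc)
  also have "\<dots> = G ** B"
    by (metis EB GE matrix_mul_assoc)
  finally show ?thesis .
qed

text \<open>Repeated use of \<open>is_group_inverse_commute\<close> makes \<open>M\<close>,
  \<open>N\<close>, \<open>G\<close> and \<open>H\<close> commute pairwise, so each defining
  equation for the product regroups into the one for \<open>M\<close> times the one for
  \<open>N\<close>.\<close>

lemma is_group_inverse_mult:
  assumes G: "is_group_inverse M G" and H: "is_group_inverse N H" and MN: "M ** N = N ** M"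
  shows "is_group_inverse (M ** N) (G ** H)" and "G ** H = H ** G"
proof -
  have NG: "N ** G = G ** N"
    using is_group_inverse_commute[OF G] MN by metis
  have MH: "M ** H = H ** M"
    using is_group_inverse_commute[OF H] MN by metis
  show GH: "G ** H = H ** G"
    using is_group_inverse_commute[OF H] NG by metis
  have MG: "M ** G ** M = M" "G ** M ** G = G" "M ** G = G ** M"
    using G unfolding is_group_inverse_def by blast+
  have NH: "N ** H ** N = N" "H ** N ** H = H" "N ** H = H ** N"
    using H unfolding is_group_inverse_def by blast+
  have p: "(M ** N) ** (G ** H) = (M ** G) ** (N ** H)"
    by (metis NG matrix_mul_assoc)
  have q: "(G ** H) ** (M ** N) = (G ** M) ** (H ** N)"
    by (metis MH matrix_mul_assoc)
  have pq: "(M ** N) ** (G ** H) = (G ** H) ** (M ** N)"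
    by (simp add: p q MG(3) NH(3))
  have "(M ** G) ** (N ** H) ** (M ** N) = (M ** G ** M) ** (N ** H ** N)"
    by (metis MN MH matrix_mul_assoc)
  moreover have "(G ** M) ** (H ** N) ** (G ** H) = (G ** M ** G) ** (H ** N ** H)"
    by (metis NG GH matrix_mul_assoc)
  ultimately show "is_group_inverse (M ** N) (G ** H)"
    unfolding is_group_inverse_def using pq
    by (simp add: p q MG(1,2) NH(1,2))
qed

lemma dual_std_sum: "dual_std (sum f S) = (\<Sum>i\<in>S. dual_std (f i))"
  by (induction S rule: infinite_finite_induct) (simp_all add: zero_dual_def plus_dual_def)

lemma dual_inf_sum: "dual_inf (sum f S) = (\<Sum>i\<in>S. dual_inf (f i))"
  by (induction S rule: infinite_finite_induct) (simp_all add: zero_dual_def plus_dual_def)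

lemma dual_matrix_nth: "dual_matrix A A0 $ i $ j = Dual (A $ i $ j) (A0 $ i $ j)"
  by (simp add: dual_matrix_def flip: Dual_eq)

lemma dual_matrix_cases: obtains A A0 where "M = dual_matrix A A0"
proof
  show "M = dual_matrix (\<chi> i j. dual_std (M $ i $ j)) (\<chi> i j. dual_inf (M $ i $ j))"
    by (simp add: vec_eq_iff dual_matrix_nth)
qed

lemma dual_matrix_eq_iff: "dual_matrix A A0 = dual_matrix B B0 \<longleftrightarrow> A = B \<and> A0 = B0"
  by (auto simp: vec_eq_iff dual_matrix_nth)

text \<open>The product \<open>A0 ** B0\<close> would carry the square of \<open>dual_eps\<close>,
  so it drops out.\<close>

lemma dual_matrix_mult:
  "dual_matrix A A0 ** dual_matrix B B0 = dual_matrix (A ** B) (A ** B0 + A0 ** B)"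
  by (simp add: vec_eq_iff dual_matrix_nth matrix_matrix_mult_def dual.expand dual_std_sum
      dual_inf_sum times_dual_def sum.distrib)

text \<open>Taking standard parts is multiplicative, so it preserves the three defining
  equations.\<close>

lemma is_group_inverse_dual_matrixD:
  assumes "is_group_inverse (dual_matrix A A0) (dual_matrix G G0)"
  shows "is_group_inverse A G"
  using assms unfolding is_group_inverse_def dual_matrix_mult dual_matrix_eq_iff by blast

text \<open>This guarantees that \<open>group_inverse A\<close> is a genuine group inverse and not
  an unspecified value.\<close>

lemma has_group_inverse_dual_matrixD: "has_group_inverse (dual_matrix A A0) \<Longrightarrow> has_group_inverse A"
  unfolding has_group_inverse_def by (metis dual_matrix_cases is_group_inverse_dual_matrixD)

theorem corollary5p2:
  fixes A A0 C C0 :: "real^'n^'n"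
    and X Y :: "dual^'n^'n"
  assumes "X = dual_matrix A A0"
    and "Y = dual_matrix C C0"
    and "index_one A"
    and "index_one C"
    and "has_group_inverse X"
    and "has_group_inverse Y"
    and "has_group_inverse (X ** Y)"
    and "A ** group_inverse A ** A0 = A0"
    and "A0 ** A ** group_inverse A = A0"
    and "C ** group_inverse C ** C0 = C0"
    and "C0 ** C ** group_inverse C = C0"
    and "A ** C = C ** A"
    and "group_inverse C ** A0 = A0 ** group_inverse C"
    and "group_inverse A ** C0 = C0 ** group_inverse A"
  shows "group_inverse (X ** Y) = group_inverse X ** group_inverse Y
       \<and> group_inverse X ** group_inverse Y = group_inverse Y ** group_inverse X"
proof -
  have GA: "is_group_inverse (group_inverse A) A" and GC: "is_group_inverse (group_inverse C) C"
    using assms(1,2,5,6)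
    by (auto intro: is_group_inverse_sym is_group_inverse_group_inverse has_group_inverse_dual_matrixD)
  have "A0 ** C = C ** A0"
    using is_group_inverse_commute[OF GC] assms(13) by metis
  moreover have "C0 ** A = A ** C0"
    using is_group_inverse_commute[OF GA] assms(14) by metis
  \<comment> \<open>The infinitesimal parts are \<open>A ** C0 + A0 ** C\<close> and
    \<open>C ** A0 + C0 ** A\<close>, which agree term by term after swapping the summands.\<close>
  ultimately have XY: "X ** Y = Y ** X"
    using assms(12) by (simp add: assms(1,2) dual_matrix_mult add.commute)
  note prod = is_group_inverse_mult[OF is_group_inverse_group_inverse[OF assms(5)]
      is_group_inverse_group_inverse[OF assms(6)] XY]
  show ?thesis
    using group_inverse_eqI[OF prod(1)] prod(2) by blast
qed

end
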